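(* Let $(Z,d)$ be a finite ep-metric space with a chosen neighbourhood $N_z$ of each $z \in Z$, and let $x,y \in Z$. For each real parameter value $s \geq 0$, there is a path from $x$ to $y$ in the ray complex $R_s(N)$ if and only if there is a finite sequence of elements $$x=x_0, x_1, \dots, x_r = y$$ of $Z$, with neighbourhoods $N_{x_i}$ of $x_i$, such that $(N_{x_i})_s \cap (N_{x_{i+1}})_s \neq \emptyset$ for all $0 \leq i < r$.
   Context: An ep-metric space (extended pseudo-metric space) $(Z,d)$ is a set $Z$ with a function $d : Z\times Z \to [0,\infty]$ such that $d(x,x)=0$, $d(x,y)=d(y,x)$ and $d(x,z) \leq d(x,y)+d(y,z)$. Distinct points may have distance $0$, and distances may be infinite. A neighbourhood of $x \in Z$ is a subset $N \subset Z$ with $x \in N$ and $d(x,y)<\infty$ for all $y \in N$. For the family $N = \{N_z\}_{z\in Z}$, the ray complex $R_s(N)$ is the graph with vertex set $Z$ and with an edge $\{u,v\}$ whenever $v \in N_u-\{u\}$ and $d(u,v) \leq s$ (for one of the two orderings of the pair). Write $(N_z)_s = \{ v \in N_z \mid d(z,v) \leq s \}$. *)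

theory Defs
  imports "HOL-Library.Extended_Nonnegative_Real"
begin

definition ep_metric_space :: "'a set \<Rightarrow> ('a \<Rightarrow> 'a \<Rightarrow> ennreal) \<Rightarrow> bool" where
  "ep_metric_space Z d \<longleftrightarrow>
     (\<forall>x\<in>Z. d x x = 0) \<and>
     (\<forall>x\<in>Z. \<forall>y\<in>Z. d x y = d y x) \<and>
     (\<forall>x\<in>Z. \<forall>y\<in>Z. \<forall>z\<in>Z. d x z \<le> d x y + d y z)"

definition ep_neighbourhood :: "'a set \<Rightarrow> ('a \<Rightarrow> 'a \<Rightarrow> ennreal) \<Rightarrow> 'a \<Rightarrow> 'a set \<Rightarrow> bool" where
  "ep_neighbourhood Z d x M \<longleftrightarrow> M \<subseteq> Z \<and> x \<in> M \<and> (\<forall>y\<in>M. d x y < \<infinity>)"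

text \<open>Undirected graphs are pairs of a vertex set and a set of two-element sets of vertices.\<close>

type_synonym 'a graph = "'a set \<times> 'a set set"

text \<open>The unordered pair \<open>{u, v}\<close> is an edge as soon as one of its two orderings
  satisfies the condition.\<close>

definition ray_complex ::
    "'a set \<Rightarrow> ('a \<Rightarrow> 'a \<Rightarrow> ennreal) \<Rightarrow> ('a \<Rightarrow> 'a set) \<Rightarrow> real \<Rightarrow> 'a graph" where
  "ray_complex Z d N s =
     (Z, {{u, v} |u v. u \<in> Z \<and> v \<in> N u - {u} \<and> d u v \<le> ennreal s})"

text \<open>A path is the list of its successive vertices; vertices may be repeated, and a single
  vertex is a path of length zero.\<close>

definition graph_path :: "'a graph \<Rightarrow> 'a \<Rightarrow> 'a list \<Rightarrow> 'a \<Rightarrow> bool" where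
  "graph_path G x p y \<longleftrightarrow>
     p \<noteq> [] \<and> hd p = x \<and> last p = y \<and> set p \<subseteq> fst G \<and>
     successively (\<lambda>u v. {u, v} \<in> snd G) p"

definition nbhd_within ::
    "('a \<Rightarrow> 'a \<Rightarrow> ennreal) \<Rightarrow> ('a \<Rightarrow> 'a set) \<Rightarrow> real \<Rightarrow> 'a \<Rightarrow> 'a set" where
  "nbhd_within d N s z = {v \<in> N z. d z v \<le> ennreal s}"

end

theory Submission
  imports Defs
begin

text \<open>
  Both sides assert that \<open>x\<close> and \<open>y\<close> are linked by a finite chain of steps, so each is the
  reflexive transitive closure of a one-step relation on \<open>Z\<close>: adjacency in the ray complex on
  the left, and meeting of the restricted neighbourhoods on the right. It therefore suffices that
  each relation is contained in the closure of the other.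

  If \<open>u\<close> and \<open>v\<close> are adjacent, then one endpoint lies in the restricted neighbourhood of the
  other. It also lies in its own, because \<open>d\<close> vanishes on the diagonal, so the two neighbourhoods
  meet there. Conversely, if the restricted neighbourhoods of \<open>u\<close> and \<open>v\<close> meet at \<open>w\<close>, then
  \<open>w\<close> is equal or adjacent to each of \<open>u\<close> and \<open>v\<close>, and the walk through \<open>u\<close>, \<open>w\<close>, \<open>v\<close>
  connects them.
\<close>

definition adjacent :: "'a graph \<Rightarrow> 'a \<Rightarrow> 'a \<Rightarrow> bool" where
  "adjacent G u v \<longleftrightarrow> v \<in> fst G \<and> {u, v} \<in> snd G"

definition nbhds_meet ::
    "'a set \<Rightarrow> ('a \<Rightarrow> 'a \<Rightarrow> ennreal) \<Rightarrow> ('a \<Rightarrow> 'a set) \<Rightarrow> real \<Rightarrow> 'a \<Rightarrow> 'a \<Rightarrow> bool" where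
  "nbhds_meet Z d N s u v \<longleftrightarrow>
     u \<in> Z \<and> v \<in> Z \<and> nbhd_within d N s u \<inter> nbhd_within d N s v \<noteq> {}"

lemma graph_path_imp_adjacent_rtranclp:
  "graph_path G x p y \<Longrightarrow> (adjacent G)\<^sup>*\<^sup>* x y"
proof (induction p arbitrary: x)
  case Nil
  then show ?case by (simp add: graph_path_def)
next
  case (Cons a q)
  show ?case
  proof (cases q)
    case Nil
    with Cons.prems show ?thesis by (auto simp: graph_path_def)
  next
    case (Cons b q')
    with Cons.prems have "adjacent G x b" "graph_path G b q y"
      by (auto simp: graph_path_def adjacent_def)
    with Cons.IH show ?thesis
      by (meson converse_rtranclp_into_rtranclp)
  qed
qed

lemma graph_path_snoc:
  assumes "graph_path G x p y" and "adjacent G y z"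
  shows "graph_path G x (p @ [z]) z"
  using assms by (auto simp: graph_path_def adjacent_def successively_append_iff)

lemma ex_graph_path_iff_rtranclp:
  assumes "x \<in> fst G"
  shows "(\<exists>p. graph_path G x p y) \<longleftrightarrow> (adjacent G)\<^sup>*\<^sup>* x y"
proof
  assume "(adjacent G)\<^sup>*\<^sup>* x y"
  then show "\<exists>p. graph_path G x p y"
  proof (induction rule: rtranclp_induct)
    case base
    have "graph_path G x [x] x"
      using assms by (simp add: graph_path_def)
    then show ?case ..
  next
    case (step y z)
    then show ?case using graph_path_snoc by metis
  qed
qed (blast intro: graph_path_imp_adjacent_rtranclp)

lemma ex_chain_iff_rtranclp:
  assumes "x \<in> Z"
  shows "(\<exists>(r::nat) c. c 0 = x \<and> c r = y \<and> (\<forall>i\<le>r. c i \<in> Z) \<and>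
           (\<forall>i<r. nbhd_within d N s (c i) \<inter> nbhd_within d N s (c (Suc i)) \<noteq> {}))
         \<longleftrightarrow> (nbhds_meet Z d N s)\<^sup>*\<^sup>* x y"
proof -
  have "(c 0 = x \<and> c r = y \<and> (\<forall>i\<le>r. c i \<in> Z) \<and>
           (\<forall>i<r. nbhd_within d N s (c i) \<inter> nbhd_within d N s (c (Suc i)) \<noteq> {}))
        \<longleftrightarrow> (c 0 = x \<and> c r = y \<and> (\<forall>i<r. nbhds_meet Z d N s (c i) (c (Suc i))))"
    (is "?L \<longleftrightarrow> ?R") for r :: nat and c
  proof
    assume ?R
    \<comment> \<open>The steps put every \<open>c i\<close> with \<open>i > 0\<close> into \<open>Z\<close>; for \<open>i = 0\<close>, notably when the chain
        has no steps, membership comes from \<open>x \<in> Z\<close>.\<close>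
    have "c i \<in> Z" if "i \<le> r" for i
      using \<open>?R\<close> assms that by (cases i) (auto simp: nbhds_meet_def)
    with \<open>?R\<close> show ?L by (auto simp: nbhds_meet_def)
  qed (auto simp: nbhds_meet_def)
  then show ?thesis
    by (simp add: rtranclp_power relpowp_fun_conv)
qed

lemma adjacent_ray_complex_imp_nbhds_meet:
  assumes "ep_metric_space Z d"
    and "\<And>z. z \<in> Z \<Longrightarrow> ep_neighbourhood Z d z (N z)"
    and "adjacent (ray_complex Z d N s) u v"
  shows "nbhds_meet Z d N s u v"
proof -
  have self: "z \<in> nbhd_within d N s z" if "z \<in> Z" for z
    using assms(1,2) that
    by (auto simp: ep_metric_space_def ep_neighbourhood_def nbhd_within_def)
  obtain a b where "{u, v} = {a, b}" and a: "a \<in> Z" and b: "b \<in> nbhd_within d N s a"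
    using assms(3) by (auto simp: adjacent_def ray_complex_def nbhd_within_def)
  moreover have "b \<in> Z"
    using a b assms(2) by (auto simp: ep_neighbourhood_def nbhd_within_def)
  ultimately show ?thesis
    using self by (auto simp: nbhds_meet_def doubleton_eq_iff)
qed

text \<open>
  The case \<open>w = u\<close> arises because the ray complex has no loops, whereas a point belongs to its
  own restricted neighbourhood. Both orientations are needed: a walk enters a common point
  from one centre and leaves it towards the other.
\<close>

lemma nbhd_within_imp_eq_or_adjacent:
  assumes "u \<in> Z" and "w \<in> Z" and "w \<in> nbhd_within d N s u"
  shows "w = u \<or> adjacent (ray_complex Z d N s) u w \<and> adjacent (ray_complex Z d N s) w u"
  using assms by (auto simp: adjacent_def ray_complex_def nbhd_within_def)

lemma nbhds_meet_imp_adjacent_rtranclp: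
  assumes "\<And>z. z \<in> Z \<Longrightarrow> ep_neighbourhood Z d z (N z)"
    and "nbhds_meet Z d N s u v"
  shows "(adjacent (ray_complex Z d N s))\<^sup>*\<^sup>* u v"
proof -
  obtain w where uv: "u \<in> Z" "v \<in> Z"
    and w: "w \<in> nbhd_within d N s u" "w \<in> nbhd_within d N s v"
    using assms(2) by (auto simp: nbhds_meet_def)
  have "w \<in> Z"
    using assms(1) uv w by (auto simp: ep_neighbourhood_def nbhd_within_def)
  have "(adjacent (ray_complex Z d N s))\<^sup>*\<^sup>* u w"
    using nbhd_within_imp_eq_or_adjacent[OF uv(1) \<open>w \<in> Z\<close> w(1)] by auto
  also have "(adjacent (ray_complex Z d N s))\<^sup>*\<^sup>* w v"
    using nbhd_within_imp_eq_or_adjacent[OF uv(2) \<open>w \<in> Z\<close> w(2)] by auto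
  finally show ?thesis .
qed

theorem lemma14:
  fixes Z :: "'a set"
    and d :: "'a \<Rightarrow> 'a \<Rightarrow> ennreal"
    and N :: "'a \<Rightarrow> 'a set"
    and x y :: 'a
    and s :: real
  assumes "finite Z"
    and "ep_metric_space Z d"
    and "\<And>z. z \<in> Z \<Longrightarrow> ep_neighbourhood Z d z (N z)"
    and "x \<in> Z" and "y \<in> Z"
    and "s \<ge> 0"
  shows "(\<exists>p. graph_path (ray_complex Z d N s) x p y) \<longleftrightarrow>
    (\<exists>(r::nat) (c :: nat \<Rightarrow> 'a).
        c 0 = x \<and> c r = y \<and> (\<forall>i\<le>r. c i \<in> Z) \<and>
        (\<forall>i<r. nbhd_within d N s (c i) \<inter> nbhd_within d N s (c (Suc i)) \<noteq> {}))"
proof -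
  have "adjacent (ray_complex Z d N s) \<le> nbhds_meet Z d N s"
    using adjacent_ray_complex_imp_nbhds_meet[OF assms(2,3)] by blast
  moreover have "nbhds_meet Z d N s \<le> (adjacent (ray_complex Z d N s))\<^sup>*\<^sup>*"
    using nbhds_meet_imp_adjacent_rtranclp[OF assms(3)] by blast
  ultimately have "(nbhds_meet Z d N s)\<^sup>*\<^sup>* = (adjacent (ray_complex Z d N s))\<^sup>*\<^sup>*"
    by (rule rtranclp_subset)
  moreover have "x \<in> fst (ray_complex Z d N s)"
    using assms(4) by (simp add: ray_complex_def)
  ultimately show ?thesis
    by (simp add: ex_graph_path_iff_rtranclp ex_chain_iff_rtranclp[OF assms(4)])
qed

end
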